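(* Let $\Delta$ be a matroid complex of rank $3$ (equivalently, of dimension $2$). Then the $h$-vector of $\Delta$ is a pure $O$-sequence.
   Context: A simplicial complex $\Delta$ with vertices $V=\{1,\dots,n\}$ is a collection of subsets of $V$ (faces) closed under taking subsets; the dimension of a face $F$ is $|F|-1$, and $\dim\Delta$ is the maximum dimension of its faces. $\Delta$ is pure if all its maximal faces have the same dimension. $\Delta$ is a matroid complex if for every $W\subseteq V$ the restriction $\Delta|_W=\{F\in\Delta \mid F\subseteq W\}$ is pure. The rank of $\Delta$ is $d=\dim\Delta+1$. Let $f_{i}$ be the number of $i$-dimensional faces of $\Delta$ (so $f_{-1}=1$). The $h$-vector $h(\Delta)=(h_0,\dots,h_d)$ is defined by $\sum_{i=0}^d f_{i-1}t^i(1-t)^{d-i}=\sum_{i=0}^d h_it^i$. The $h$-vector of a simplicial complex is allowed to end with some trailing $0$'s; such trailing zeros are disregarded when saying that it is a pure $O$-sequence. A (monomial) order ideal is a finite nonempty set $X$ of monic monomials in indeterminates $y_1,\dots,y_r$ such that if $M\in X$ and $N$ divides $M$ then $N\in X$. It is pure if all its monomials that are maximal under divisibility have the same degree. The $h$-vector of $X$ is $(h_0=1,h_1,\dots,h_e)$, where $h_i$ is the number of monomials of degree $i$ in $X$ and $e$ is the largest degree of a monomial in $X$. A pure $O$-sequence is the $h$-vector of a pure order ideal. *)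

theory Defs
  imports
    "HOL-Library.Multiset"
    "HOL-Library.More_List"
    "HOL-Computational_Algebra.Polynomial"
begin

section \<open>Simplicial complexes and matroid complexes\<close>

text \<open>
  The empty face always belongs to a complex (so that \<open>f\<^sub>-\<^sub>1 = 1\<close>).  Elements of \<open>V\<close> are not
  required to be faces themselves, so a matroid complex may have loops.
\<close>

definition simplicial_complex :: "'a set \<Rightarrow> 'a set set \<Rightarrow> bool" where
  "simplicial_complex V \<Delta> \<longleftrightarrow>
     finite V \<and> \<Delta> \<subseteq> Pow V \<and> {} \<in> \<Delta> \<and> (\<forall>F\<in>\<Delta>. \<forall>G. G \<subseteq> F \<longrightarrow> G \<in> \<Delta>)"

definition face_dim :: "'a set \<Rightarrow> int" where
  "face_dim F = int (card F) - 1"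

definition complex_dim :: "'a set set \<Rightarrow> int" where
  "complex_dim \<Delta> = Max (face_dim ` \<Delta>)"

definition complex_rank :: "'a set set \<Rightarrow> nat" where
  "complex_rank \<Delta> = nat (complex_dim \<Delta> + 1)"

definition maximal_faces :: "'a set set \<Rightarrow> 'a set set" where
  "maximal_faces \<Delta> = {F \<in> \<Delta>. \<forall>G\<in>\<Delta>. F \<subseteq> G \<longrightarrow> G = F}"

definition pure_complex :: "'a set set \<Rightarrow> bool" where
  "pure_complex \<Delta> \<longleftrightarrow>
     (\<forall>F\<in>maximal_faces \<Delta>. \<forall>G\<in>maximal_faces \<Delta>. face_dim F = face_dim G)"

definition complex_restrict :: "'a set set \<Rightarrow> 'a set \<Rightarrow> 'a set set" where
  "complex_restrict \<Delta> W = {F \<in> \<Delta>. F \<subseteq> W}"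

definition matroid_complex :: "'a set \<Rightarrow> 'a set set \<Rightarrow> bool" where
  "matroid_complex V \<Delta> \<longleftrightarrow>
     simplicial_complex V \<Delta> \<and> (\<forall>W. W \<subseteq> V \<longrightarrow> pure_complex (complex_restrict \<Delta> W))"


section \<open>The h-vector of a simplicial complex\<close>

definition f_number :: "'a set set \<Rightarrow> int \<Rightarrow> nat" where
  "f_number \<Delta> i = card {F \<in> \<Delta>. face_dim F = i}"

text \<open>
  The polynomial \<open>\<Sum>i=0..d. f\<^sub>i\<^sub>-\<^sub>1 t^i (1 - t)^(d - i)\<close> in \<open>t\<close>; here \<open>[:1, -1:]\<close> is \<open>1 - t\<close>.
\<close>

definition h_poly :: "'a set set \<Rightarrow> int poly" where
  "h_poly \<Delta> =
     (\<Sum>i=0..complex_rank \<Delta>.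
        smult (int (f_number \<Delta> (int i - 1)))
          (monom 1 i * [:1, -1:] ^ (complex_rank \<Delta> - i)))"

definition h_vector :: "'a set set \<Rightarrow> int list" where
  "h_vector \<Delta> = map (coeff (h_poly \<Delta>)) [0..<complex_rank \<Delta> + 1]"

lemma length_h_vector [simp]: "length (h_vector \<Delta>) = complex_rank \<Delta> + 1"
  by (simp add: h_vector_def)

text \<open>No coefficient is cut off: the list satisfies the defining identity of the h-vector.\<close>

lemma h_poly_eq_h_vector:
  "h_poly \<Delta> = (\<Sum>i=0..complex_rank \<Delta>. monom (h_vector \<Delta> ! i) i)"
proof -
  let ?d = "complex_rank \<Delta>"
  have "degree (h_poly \<Delta>) \<le> ?d"
    unfolding h_poly_def
  proof (rule degree_sum_le)
    fix i assume "i \<in> {0..?d}"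
    hence i: "i \<le> ?d" by simp
    have "degree ([:1, -1:] ^ (?d - i) :: int poly) \<le> ?d - i"
      using degree_power_le[of "[:1, -1:] :: int poly" "?d - i"] by simp
    moreover have "degree (monom 1 i :: int poly) \<le> i" by (rule degree_monom_le)
    ultimately have "degree (monom 1 i * [:1, -1:] ^ (?d - i) :: int poly) \<le> ?d"
      using degree_mult_le[of "monom 1 i :: int poly" "[:1, -1:] ^ (?d - i)"] i by linarith
    thus "degree (smult (int (f_number \<Delta> (int i - 1)))
            (monom 1 i * [:1, -1:] ^ (?d - i))) \<le> ?d"
      using degree_smult_le order_trans by blast
  qed simp
  hence "h_poly \<Delta> = (\<Sum>i\<le>?d. monom (coeff (h_poly \<Delta>) i) i)"
    by (rule poly_as_sum_of_monoms'[symmetric])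
  also have "\<dots> = (\<Sum>i=0..?d. monom (h_vector \<Delta> ! i) i)"
    by (rule sum.cong) (auto simp: h_vector_def simp del: upt_Suc)
  finally show ?thesis .
qed


section \<open>Monomial order ideals and pure O-sequences\<close>

text \<open>
  A monic monomial in \<open>y\<^sub>1, \<dots>, y\<^sub>r\<close> is a multiset over \<open>{1..r}\<close>, the exponent of \<open>y\<^sub>i\<close> being the
  multiplicity of \<open>i\<close>.  Divisibility is then \<open>\<subseteq>#\<close> and the degree is \<open>size\<close>.
\<close>

definition monomials :: "nat \<Rightarrow> nat multiset set" where
  "monomials r = {M. set_mset M \<subseteq> {1..r}}"

definition order_ideal :: "nat \<Rightarrow> nat multiset set \<Rightarrow> bool" where
  "order_ideal r X \<longleftrightarrow>
     finite X \<and> X \<noteq> {} \<and> X \<subseteq> monomials r \<and> (\<forall>M\<in>X. \<forall>N. N \<subseteq># M \<longrightarrow> N \<in> X)"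

definition maximal_monomials :: "nat multiset set \<Rightarrow> nat multiset set" where
  "maximal_monomials X = {M \<in> X. \<forall>N\<in>X. M \<subseteq># N \<longrightarrow> N = M}"

definition pure_order_ideal :: "nat \<Rightarrow> nat multiset set \<Rightarrow> bool" where
  "pure_order_ideal r X \<longleftrightarrow>
     order_ideal r X \<and> (\<forall>M\<in>maximal_monomials X. \<forall>N\<in>maximal_monomials X. size M = size N)"

definition order_ideal_h_vector :: "nat multiset set \<Rightarrow> nat list" where
  "order_ideal_h_vector X =
     map (\<lambda>i. card {M \<in> X. size M = i}) [0..<Max (size ` X) + 1]"

text \<open>
  The entries are integers because those of \<^const>\<open>h_vector\<close> are; a sequence with a negative
  entry is simply not a pure O-sequence.
\<close>

definition pure_O_sequence :: "int list \<Rightarrow> bool" where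
  "pure_O_sequence h \<longleftrightarrow>
     (\<exists>r X. pure_order_ideal r X \<and> h = map int (order_ideal_h_vector X))"

definition drop_trailing_zeros :: "int list \<Rightarrow> int list" where
  "drop_trailing_zeros h = strip_while (\<lambda>x. x = 0) h"

end

theory Submission
  imports Defs
begin

text \<open>
  Let \<open>p\<^sub>1, \<dots>, p\<^sub>m\<close> be the sizes of the parallel classes of \<open>\<Delta>\<close>.  If all triples of points from distinct
  classes are bases, the \<open>h\<close>-vector counts the monomials in \<open>p\<^sub>i - 1\<close> mutually exclusive variables
  for each \<open>i\<close> and \<open>m - 3\<close> free variables.  In general there are fewer bases, which only makes \<open>h\<^sub>3\<close>
  smaller.  Suppose then \<open>m \<ge> 4\<close>, let \<open>z\<close> be one of the free variables and let \<open>q = h\<^sub>2 - h\<^sub>1\<close> be the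
  number of quadratic monomials without \<open>z\<close>.  Removing cubic monomials keeps the ideal pure if either
  all of them are removed, or \<open>z\<close> times each of the \<open>q\<close> quadratic monomials remains together with at
  least one \<open>z\<^sup>2 v\<close> (and with all \<open>z\<^sup>2 v\<close>, \<open>v \<noteq> z\<close>, when \<open>q = 0\<close>).  So it suffices that \<open>h\<^sub>3 = 0\<close> or
  \<open>h\<^sub>3 > h\<^sub>2 - h\<^sub>1\<close> when three points of distinct classes are collinear (with a slightly better bound when
  \<open>q = 0\<close>).  This follows by counting the bases with one and with two elements off their line, since a
  non-parallel pair off the line is completed to a basis by at least two of the three points.
\<close>

section \<open>Order ideals generated in degree at most 3\<close>

definition monomials_of_degree :: "nat \<Rightarrow> nat \<Rightarrow> nat multiset set" where
  "monomials_of_degree n k = {M. set_mset M \<subseteq> {1..n} \<and> size M = k}"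

lemma monomials_of_degree_Suc:
  "monomials_of_degree n (Suc k) =
     (\<lambda>(v, M). add_mset v M) ` ({1..n} \<times> monomials_of_degree n k)"
proof (intro equalityI subsetI)
  fix M assume M: "M \<in> monomials_of_degree n (Suc k)"
  hence "size M = Suc k" by (simp add: monomials_of_degree_def)
  then obtain v N where vN: "M = add_mset v N" using size_eq_Suc_imp_eq_union by blast
  with M show "M \<in> (\<lambda>(v, M). add_mset v M) ` ({1..n} \<times> monomials_of_degree n k)"
    by (auto simp: monomials_of_degree_def intro!: image_eqI[of _ _ "(v, N)"])
qed (auto simp: monomials_of_degree_def)

lemma monomials_of_degree_0: "monomials_of_degree n 0 = {{#}}"
  by (auto simp: monomials_of_degree_def)

lemma monomials_of_degree_1: "monomials_of_degree n 1 = (\<lambda>v. {#v#}) ` {1..n}"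
  unfolding One_nat_def monomials_of_degree_Suc monomials_of_degree_0 by auto

lemma finite_monomials_of_degree: "finite (monomials_of_degree n k)"
  by (induction k) (auto simp: monomials_of_degree_0 monomials_of_degree_Suc)

lemma card_monomials_of_degree_1: "card (monomials_of_degree n 1) = n"
  unfolding monomials_of_degree_1 by (subst card_image) (auto simp: inj_on_def)

lemma monomials_of_degree_mono: "n \<le> m \<Longrightarrow> monomials_of_degree n k \<subseteq> monomials_of_degree m k"
  by (fastforce simp: monomials_of_degree_def)

text \<open>\<open>A\<close> and \<open>B\<close> are the degree 2 and degree 3 parts of an order
  ideal containing 1 and all \<open>n\<close> variables. Since degrees 0 and 1 are complete,
  \<open>B_divisors\<close> is all that closure under divisibility demands. The covering conditions
  encode purity and become vacuous when the higher degree is empty.\<close>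

locale cubic_ideal =
  fixes n :: nat and A B :: "nat multiset set"
  assumes A_sub: "A \<subseteq> monomials_of_degree n 2"
    and B_sub: "B \<subseteq> monomials_of_degree n 3"
    and B_divisors: "\<And>M v. M \<in> B \<Longrightarrow> v \<in># M \<Longrightarrow> M - {#v#} \<in> A"
    and A_covers: "\<And>v. A \<noteq> {} \<Longrightarrow> v \<in> {1..n} \<Longrightarrow> \<exists>M\<in>A. v \<in># M"
    and B_covers: "\<And>M. B \<noteq> {} \<Longrightarrow> M \<in> A \<Longrightarrow> \<exists>N\<in>B. M \<subseteq># N"
begin

lemma finite_A: "finite A" and finite_B: "finite B"
  using A_sub B_sub finite_monomials_of_degree finite_subset by blast+

lemma A_D: "M \<in> A \<Longrightarrow> set_mset M \<subseteq> {1..n} \<and> size M = 2"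
  using A_sub by (auto simp: monomials_of_degree_def)

lemma B_D: "M \<in> B \<Longrightarrow> set_mset M \<subseteq> {1..n} \<and> size M = 3"
  using B_sub by (auto simp: monomials_of_degree_def)

lemma B_empty: "A = {} \<Longrightarrow> B = {}"
proof (rule ccontr)
  assume "A = {}" "B \<noteq> {}"
  then obtain M where "M \<in> B" by blast
  moreover from this have "M \<noteq> {#}" using B_D by fastforce
  ultimately show False using B_divisors \<open>A = {}\<close> by blast
qed

lemma A_empty: "n = 0 \<Longrightarrow> A = {}"
  using A_D by fastforce

definition ideal :: "nat multiset set" where
  "ideal = monomials_of_degree n 0 \<union> monomials_of_degree n 1 \<union> A \<union> B"

lemma in_idealI:
  "set_mset M \<subseteq> {1..n} \<Longrightarrow> size M \<le> 1 \<Longrightarrow> M \<in> ideal"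
  by (auto simp: ideal_def le_Suc_eq monomials_of_degree_def)

lemma order_ideal_ideal: "order_ideal n ideal"
  unfolding order_ideal_def
proof (intro conjI ballI allI impI)
  show "finite ideal"
    by (simp add: ideal_def finite_A finite_B finite_monomials_of_degree)
  show "ideal \<noteq> {}" by (auto simp: ideal_def monomials_of_degree_0)
  show "ideal \<subseteq> monomials n"
    using A_sub B_sub by (auto simp: ideal_def monomials_def monomials_of_degree_def)
next
  fix M N assume M: "M \<in> ideal" and N: "N \<subseteq># M"
  have vars: "set_mset N \<subseteq> {1..n}"
    using M A_D[of M] B_D[of M] set_mset_mono[OF N]
    unfolding ideal_def monomials_of_degree_def by blast
  show "N \<in> ideal"
  proof (cases "size N \<le> 1 \<or> N = M")
    case True thus ?thesis using vars M in_idealI by blast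
  next
    case False
    \<comment> \<open>A proper divisor of degree at least 2 can only be a quadric dividing a cubic,
      with a single variable as cofactor.\<close>
    hence "size N < size M" using N by (metis mset_subset_size subset_mset.less_le)
    hence MB: "M \<in> B" "size N = 2"
      using False M A_D[of M] B_D[of M] by (auto simp: ideal_def monomials_of_degree_def)
    have "size (M - N) = 1" using MB B_D[of M] N by (simp add: size_Diff_submset)
    then obtain v where v: "M - N = {#v#}" using size_1_singleton_mset by blast
    hence "M = add_mset v N" using N by (metis add_mset_add_single subset_mset.add_diff_inverse)
    hence "N \<in> A" using B_divisors[OF MB(1), of v] by simp
    thus ?thesis by (simp add: ideal_def)
  qed
qed

definition top_degree :: nat where
  "top_degree = (if B \<noteq> {} then 3 else if A \<noteq> {} then 2 else if n > 0 then 1 else 0)"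

lemma size_ideal_le: "M \<in> ideal \<Longrightarrow> size M \<le> top_degree"
  using A_D[of M] B_D[of M] A_empty B_empty
  unfolding ideal_def top_degree_def monomials_of_degree_def
  by (cases "n = 0") auto

text \<open>The property \<open>up\<close> is established from degree 3 downwards: the covering
  conditions move a monomial up one degree, and \<open>up\<close> passes to divisors.\<close>

lemma ex_top_multiple: "M \<in> ideal \<Longrightarrow> \<exists>N\<in>ideal. M \<subseteq># N \<and> size N = top_degree"
proof -
  assume M: "M \<in> ideal"
  define up where "up M \<longleftrightarrow> (\<exists>N\<in>ideal. M \<subseteq># N \<and> size N = top_degree)" for M
  have up_trans: "up M" if "up N" "M \<subseteq># N" for M N
    using that unfolding up_def by (meson subset_mset.order_trans)
  have up3: "up M" if "M \<in> B" for M
    using that B_D[OF that] unfolding up_def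
    by (intro bexI[of _ M]) (auto simp: top_degree_def ideal_def)
  have up2: "up M" if "M \<in> A" for M
  proof (cases "B = {}")
    case True
    hence "top_degree = 2" using that unfolding top_degree_def by auto
    thus ?thesis using that A_D unfolding up_def ideal_def by fastforce
  next
    case False thus ?thesis using B_covers that up3 up_trans by blast
  qed
  have up1: "up {#v#}" if "v \<in> {1..n}" for v
  proof (cases "A = {}")
    case True
    hence "top_degree = 1" using that B_empty unfolding top_degree_def by auto
    thus ?thesis using that unfolding up_def by (intro bexI[of _ "{#v#}"] in_idealI) auto
  next
    case False
    then obtain M where "M \<in> A" "v \<in># M" using A_covers[OF False \<open>v \<in> {1..n}\<close>] by blast
    thus ?thesis using up2 up_trans by (metis single_subset_iff)
  qed
  have up0: "up {#}"
  proof (cases "n = 0")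
    case True
    hence "top_degree = 0" using A_empty B_empty unfolding top_degree_def by auto
    thus ?thesis unfolding up_def by (intro bexI[of _ "{#}"] in_idealI) auto
  next
    case False
    hence "up {#1#}" by (intro up1) auto
    thus ?thesis using up_trans by (meson empty_le)
  qed
  have "up M" using M up0 up1 up2 up3
    unfolding ideal_def monomials_of_degree_0 monomials_of_degree_1 by blast
  thus ?thesis by (simp add: up_def)
qed

lemma pure_ideal: "pure_order_ideal n ideal"
proof -
  have "size M = top_degree" if "M \<in> maximal_monomials ideal" for M
    using that ex_top_multiple[of M] by (auto simp: maximal_monomials_def)
  thus ?thesis using order_ideal_ideal by (auto simp: pure_order_ideal_def)
qed

lemma Max_size_ideal: "Max (size ` ideal) = top_degree"
proof (rule Max_eqI)
  show "finite (size ` ideal)" using order_ideal_ideal by (auto simp: order_ideal_def)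
  have "{#} \<in> ideal" by (simp add: in_idealI)
  then obtain N where "N \<in> ideal" "size N = top_degree" using ex_top_multiple by blast
  thus "top_degree \<in> size ` ideal" by (metis imageI)
qed (use size_ideal_le in auto)

lemma ideal_degree:
  "{M \<in> ideal. size M = 0} = monomials_of_degree n 0"
  "{M \<in> ideal. size M = 1} = monomials_of_degree n 1"
  "{M \<in> ideal. size M = 2} = A" "{M \<in> ideal. size M = 3} = B"
  using A_sub B_sub by (auto simp: ideal_def monomials_of_degree_def)

text \<open>No degree up to \<open>top_degree\<close> is empty, so the zeros stripped from the list
  are exactly the entries beyond the top degree.\<close>

lemma pure_O_sequence:
  "pure_O_sequence (drop_trailing_zeros [1, int n, int (card A), int (card B)])"
proof -
  have nA: "n \<noteq> 0" if "A \<noteq> {}" using that A_empty by blast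
  have AB: "A \<noteq> {}" if "B \<noteq> {}" using that B_empty by blast
  define N where "N i = card {M \<in> ideal. size M = i}" for i
  have N: "N 0 = 1" "N (Suc 0) = n" "N (Suc (Suc 0)) = card A" "N (Suc (Suc (Suc 0))) = card B"
    using ideal_degree card_monomials_of_degree_1
    by (simp_all add: N_def monomials_of_degree_0 numeral_2_eq_2 numeral_3_eq_3)
  have upt: "[0..<4] = [0, Suc 0, Suc (Suc 0), Suc (Suc (Suc 0))]"
      "[0..<3] = [0, Suc 0, Suc (Suc 0)]" "[0..<Suc (Suc 0)] = [0, Suc 0]" "[0..<Suc 0] = [0]"
    by (simp_all add: numeral_eq_Suc)
  have "drop_trailing_zeros [1, int n, int (card A), int (card B)]
      = map int (map N [0..<top_degree + 1])"
    unfolding top_degree_def drop_trailing_zeros_def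
    using nA AB finite_A finite_B
    by (cases "A = {}"; cases "B = {}"; cases "n = 0")
       (simp_all add: strip_while_def upt N del: upt_Suc)
  hence "drop_trailing_zeros [1, int n, int (card A), int (card B)]
      = map int (order_ideal_h_vector ideal)"
    unfolding order_ideal_h_vector_def Max_size_ideal N_def .
  thus ?thesis unfolding pure_O_sequence_def using pure_ideal by blast
qed

end

text \<open>Only the numbers of monomials in degrees 1, 2 and 3 are retained, so that ideals can be
  matched with face counts by arithmetic alone.\<close>

definition has_cubic_ideal :: "nat \<Rightarrow> nat \<Rightarrow> nat \<Rightarrow> bool" where
  "has_cubic_ideal n q c \<longleftrightarrow> (\<exists>A B. cubic_ideal n A B \<and> card A = q \<and> card B = c)"

lemma has_cubic_ideal_imp_pure_O_sequence:
  "has_cubic_ideal n q c \<Longrightarrow> pure_O_sequence (drop_trailing_zeros [1, int n, int q, int c])"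
  using cubic_ideal.pure_O_sequence by (fastforce simp: has_cubic_ideal_def)

lemma has_cubic_ideal_0: "has_cubic_ideal 0 0 0"
  unfolding has_cubic_ideal_def by (intro exI[of _ "{}"]) (auto simp: cubic_ideal_def)

lemma add_mset_in_monomials_of_degree:
  "M \<in> monomials_of_degree n k \<Longrightarrow> z \<in> {1..n} \<Longrightarrow> add_mset z M \<in> monomials_of_degree n (Suc k)"
  by (auto simp: monomials_of_degree_def)

lemma single_in_monomials_of_degree [simp]:
  "{#v#} \<in> monomials_of_degree n (Suc 0) \<longleftrightarrow> v \<in> {1..n}"
  by (auto simp: monomials_of_degree_def)

lemma monomials_of_degree_vars: "M \<in> monomials_of_degree n k \<Longrightarrow> v \<in># M \<Longrightarrow> v \<in> {1..n}"
  by (auto simp: monomials_of_degree_def)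

text \<open>A product of a new variable and an old monomial has exactly one variable outside
  \<open>{1..n}\<close>, so both factors can be recovered.\<close>

lemma card_new_multiples:
  assumes "S \<subseteq> monomials_of_degree n k" "Z \<inter> {1..n} = {}"
  shows "card ((\<lambda>(z, M). add_mset z M) ` (Z \<times> S)) = card Z * card S"
proof -
  have "inj_on (\<lambda>(z, M). add_mset z M) (Z \<times> S)"
  proof (rule inj_onI, clarify)
    fix z M z' M' assume *: "z \<in> Z" "M \<in> S" "z' \<in> Z" "M' \<in> S" "add_mset z M = add_mset z' M'"
    have "z \<notin># M'" using * assms monomials_of_degree_vars by blast
    hence "z = z'" using *(5) by (metis insert_noteq_member)
    thus "z = z' \<and> M = M'" using * by simp
  qed
  thus ?thesis by (simp add: card_image card_cartesian_product)
qed

section \<open>Adjoining variables\<close>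

lemma has_cubic_ideal_no_quadratics:
  assumes "has_cubic_ideal n 0 c"
  shows "c = 0"
proof -
  obtain A B where AB: "cubic_ideal n A B" "card A = 0" "card B = c"
    using assms by (auto simp: has_cubic_ideal_def)
  hence "A = {}" using cubic_ideal.finite_A[OF AB(1)] by simp
  thus ?thesis using cubic_ideal.B_empty[OF AB(1)] AB(3) by simp
qed

text \<open>A monomial may take at most one of \<open>s\<close> new variables, to the first power.
  This multiplies the generating polynomial by \<open>1 + s t\<close>, cut off after degree
  3.\<close>

lemma has_cubic_ideal_exclusive:
  assumes "has_cubic_ideal n q c"
  shows "has_cubic_ideal (n + s) (q + s * n) (c + s * q)"
proof (cases "s = 0")
  case False
  obtain A B where "cubic_ideal n A B" and card: "card A = q" "card B = c"
    using assms by (auto simp: has_cubic_ideal_def)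
  interpret cubic_ideal n A B by fact
  define Z where "Z = {n + 1..n + s}"
  have Z: "Z \<inter> {1..n} = {}" "finite Z" "card Z = s" "Z \<noteq> {}" "Z \<subseteq> {1..n + s}"
    using False by (auto simp: Z_def)
  define mult where "mult S = (\<lambda>(z, M). add_mset z M) ` (Z \<times> S)" for S
  have mult_iff: "N \<in> mult S \<longleftrightarrow> (\<exists>z\<in>Z. \<exists>M\<in>S. N = add_mset z M)" for N S
    by (auto simp: mult_def)
  let ?V = "monomials_of_degree n 1"
  \<comment> \<open>Products of a new variable with \<open>B\<close> would have degree 4 and are
    left out. Purity survives because new variables times \<open>A\<close> cover all
    quadrics.\<close>
  let ?A = "A \<union> mult ?V" and ?B = "B \<union> mult A"
  have mult_deg: "mult S \<subseteq> monomials_of_degree (n + s) (Suc k)"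
    if "S \<subseteq> monomials_of_degree n k" for S k
    using that Z monomials_of_degree_mono[of n "n + s" k]
    by (fastforce simp: mult_iff intro: add_mset_in_monomials_of_degree)
  have disj: "S' \<inter> mult S = {}" if "S' \<subseteq> monomials_of_degree n k" for S S' k
    using that Z monomials_of_degree_vars by (fastforce simp: mult_iff)
  have fin: "finite (mult S)" if "finite S" for S using that Z by (simp add: mult_def)
  have "cubic_ideal (n + s) ?A ?B"
  proof
    show "?A \<subseteq> monomials_of_degree (n + s) 2"
      using A_sub mult_deg[of ?V 1] monomials_of_degree_mono[of n "n + s" 2] by (auto simp: numeral_2_eq_2)
    show "?B \<subseteq> monomials_of_degree (n + s) 3"
      using B_sub A_sub mult_deg[of A 2] monomials_of_degree_mono[of n "n + s" 3] by (auto simp: numeral_3_eq_3 numeral_2_eq_2)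
  next
    fix M v assume M: "M \<in> ?B" and v: "v \<in># M"
    show "M - {#v#} \<in> ?A"
    proof (cases "M \<in> B")
      case True thus ?thesis using B_divisors v by blast
    next
      case False
      then obtain z N where zN: "z \<in> Z" "N \<in> A" "M = add_mset z N" using M by (auto simp: mult_iff)
      show ?thesis
      proof (cases "v = z")
        case True thus ?thesis using zN by simp
      next
        case False
        hence vN: "v \<in># N" using zN v by simp
        have "N - {#v#} \<in> ?V" using vN A_D[OF zN(2)] in_diffD[of _ N]
          by (fastforce simp: monomials_of_degree_def size_Diff_singleton)
        moreover have "M - {#v#} = add_mset z (N - {#v#})" using zN False by auto
        ultimately show ?thesis using zN by (auto simp: mult_iff)
      qed
    qed
  next
    fix v assume A: "?A \<noteq> {}" and v: "v \<in> {1..n + s}"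
    \<comment> \<open>An old variable is needed as a partner for the new ones; \<open>1\<close>
      serves below.\<close>
    have n: "n \<ge> 1" using A A_empty by (cases n) (auto simp: mult_def monomials_of_degree_1 simp del: One_nat_def)
    obtain z where z: "z \<in> Z" using Z by blast
    have mem: "{#z, w#} \<in> mult ?V" if "z \<in> Z" "w \<in> {1..n}" for z w
      using that by (auto simp: mult_iff intro!: bexI[of _ z] bexI[of _ "{#w#}"])
    show "\<exists>M\<in>?A. v \<in># M"
    proof (cases "v \<le> n")
      case True
      thus ?thesis using mem[OF z, of v] v by (intro bexI[of _ "{#z, v#}"]) auto
    next
      case False
      thus ?thesis using mem[of v 1] v n by (intro bexI[of _ "{#v, 1#}"]) (auto simp: Z_def)
    qed
  next
    fix M assume B: "?B \<noteq> {}" and M: "M \<in> ?A"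
    have A: "A \<noteq> {}" using B B_empty by (auto simp: mult_def)
    obtain z where z: "z \<in> Z" using Z by blast
    show "\<exists>N\<in>?B. M \<subseteq># N"
    proof (cases "M \<in> A")
      case True
      thus ?thesis using z by (intro bexI[of _ "add_mset z M"]) (auto simp: mult_iff)
    next
      case False
      then obtain y w where yw: "y \<in> Z" "w \<in> {1..n}" "M = {#y, w#}"
        using M by (auto simp: mult_iff monomials_of_degree_1 simp del: One_nat_def)
      then obtain N where "N \<in> A" "w \<in># N" using A_covers A by blast
      thus ?thesis using yw by (intro bexI[of _ "add_mset y N"]) (auto simp: mult_iff)
    qed
  qed
  moreover have "card ?A = q + s * n"
    using card Z A_sub card_new_multiples[of ?V n 1 Z] disj[of A 2 ?V]
    by (subst card_Un_disjoint) (auto simp: finite_A fin finite_monomials_of_degree mult_def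
        card_monomials_of_degree_1 simp del: One_nat_def)
  moreover have "card ?B = c + s * q"
    using card Z A_sub B_sub card_new_multiples[of A n 2 Z] disj[of B 3 A]
    by (subst card_Un_disjoint) (auto simp: finite_A finite_B fin mult_def)
  ultimately show ?thesis by (auto simp: has_cubic_ideal_def)
qed (use assms in simp)

lemma has_cubic_ideal_free:
  assumes "has_cubic_ideal n q c"
    and h: "h = 0 \<or> (0 < q \<and> q + 1 \<le> h \<and> h \<le> q + n + 1 + c) \<or>
              (q = 0 \<and> 1 \<le> h \<and> n \<le> h \<and> h \<le> n + 1)"
  shows "has_cubic_ideal (n + 1) (q + n + 1) h"
proof -
  obtain A B where "cubic_ideal n A B" and card: "card A = q" "card B = c"
    using assms by (auto simp: has_cubic_ideal_def)
  interpret cubic_ideal n A B by fact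
  define z where "z = n + 1"
  let ?V = "monomials_of_degree (n + 1) 1"
  let ?A = "A \<union> add_mset z ` ?V"
  have zA: "z \<notin># M" if "M \<in> A" for M using A_D[OF that] by (auto simp: z_def)
  have zB: "z \<notin># M" if "M \<in> B" for M using B_D[OF that] by (auto simp: z_def)
  have memV: "{#z, w#} \<in> add_mset z ` ?V" if "w \<in> {1..n + 1}" for w
    using that by (auto intro!: image_eqI[of _ _ "{#w#}"])
  have A_sub': "?A \<subseteq> monomials_of_degree (n + 1) 2"
  proof -
    have "add_mset z ` ?V \<subseteq> monomials_of_degree (n + 1) (Suc 1)"
      by (auto intro!: add_mset_in_monomials_of_degree simp: z_def)
    thus ?thesis using A_sub monomials_of_degree_mono[of n "n + 1" 2] by (auto simp: numeral_2_eq_2)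
  qed
  have A_covers': "\<exists>M\<in>?A. v \<in># M" if "v \<in> {1..n + 1}" for v
    using memV[OF that] by (intro bexI[of _ "{#z, v#}"]) auto
  have card_A': "card ?A = q + n + 1"
  proof -
    have "A \<inter> add_mset z ` ?V = {}" using zA by fastforce
    moreover have "card (add_mset z ` ?V) = n + 1"
      using card_monomials_of_degree_1[of "n + 1"] by (subst card_image) (auto simp: inj_on_def)
    ultimately show ?thesis
      using card by (simp add: card_Un_disjoint finite_A finite_monomials_of_degree)
  qed
  \<comment> \<open>\<open>T\<close> selects the monomials \<open>z^2 t\<close> that are kept and
    \<open>C\<close> the old cubics. Old cubics are used only once every \<open>z^2 t\<close> is
    taken.\<close>
  have "\<exists>T C. T \<subseteq> {1..n + 1} \<and> C \<subseteq> B \<and> q + card T + card C = h \<and> T \<noteq> {} \<and>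
          (q = 0 \<longrightarrow> {1..n} \<subseteq> T)" if "h \<noteq> 0"
  proof (cases "h \<le> q + n + 1")
    case True
    define T where "T = {1..h - q}"
    have "T \<subseteq> {1..n + 1}" "q + card T = h" "T \<noteq> {}" "q = 0 \<longrightarrow> {1..n} \<subseteq> T"
      using True h that by (auto simp: T_def)
    thus ?thesis by (intro exI[of _ T] exI[of _ "{}"]) auto
  next
    case False
    hence "h - (q + n + 1) \<le> card B" using h card by auto
    then obtain C where "C \<subseteq> B" "card C = h - (q + n + 1)" by (meson obtain_subset_with_card_n)
    thus ?thesis using False by (intro exI[of _ "{1..n + 1}"] exI[of _ C]) auto
  qed
  hence "\<exists>B'. cubic_ideal (n + 1) ?A B' \<and> card B' = h"
  proof (cases "h = 0")
    case True
    have "cubic_ideal (n + 1) ?A {}"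
      by unfold_locales (use A_sub' A_covers' in auto)
    thus ?thesis using True by (intro exI[of _ "{}"]) auto
  next
    case False
    then obtain T C where T: "T \<subseteq> {1..n + 1}" "T \<noteq> {}" "q = 0 \<Longrightarrow> {1..n} \<subseteq> T"
      and C: "C \<subseteq> B" and sum: "q + card T + card C = h"
      using \<open>h \<noteq> 0 \<Longrightarrow> _\<close> by blast
    define S where "S = (\<lambda>t. {#z, t#}) ` T"
    let ?B = "add_mset z ` (A \<union> S) \<union> C"
    have S: "S \<subseteq> add_mset z ` ?V" using T memV by (auto simp: S_def)
    have finT: "finite T" using T finite_subset by blast
    have card_S: "card S = card T" unfolding S_def by (rule card_image) (auto simp: inj_on_def)
    have disj: "A \<inter> S = {}" using zA unfolding S_def by fastforce
    have disj': "add_mset z ` (A \<union> S) \<inter> C = {}" using zB C by fastforce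
    have "card ?B = card (add_mset z ` (A \<union> S)) + card C"
      using disj' finite_A finite_subset[OF C finite_B] finT
      by (intro card_Un_disjoint) (auto simp: S_def)
    also have "card (add_mset z ` (A \<union> S)) = card (A \<union> S)"
      by (rule card_image) (auto simp: inj_on_def)
    also have "\<dots> = card A + card S"
      using disj finite_A finT by (intro card_Un_disjoint) (auto simp: S_def)
    finally have card_B': "card ?B = h" using sum card card_S by simp
    have "cubic_ideal (n + 1) ?A ?B"
    proof
      show "?A \<subseteq> monomials_of_degree (n + 1) 2" by (rule A_sub')
      have "add_mset z ` (A \<union> S) \<subseteq> monomials_of_degree (n + 1) (Suc 2)"
      proof (rule image_subsetI)
      fix N assume "N \<in> A \<union> S"
      hence "N \<in> monomials_of_degree (n + 1) 2" using A_sub' S by blast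
      thus "add_mset z N \<in> monomials_of_degree (n + 1) (Suc 2)"
        by (rule add_mset_in_monomials_of_degree) (simp add: z_def)
    qed
      thus "?B \<subseteq> monomials_of_degree (n + 1) 3"
        using C B_sub monomials_of_degree_mono[of n "n + 1" 3] by (auto simp: numeral_3_eq_3)
    next
      fix M v assume M: "M \<in> ?B" and v: "v \<in># M"
      show "M - {#v#} \<in> ?A"
      proof (cases "M \<in> C")
        case True thus ?thesis using B_divisors v C by blast
      next
        case False
        then obtain N where N: "N \<in> A \<union> S" "M = add_mset z N" using M by auto
        show ?thesis
        proof (cases "v = z")
          case True thus ?thesis using N S by auto
        next
          case False
          hence vN: "v \<in># N" using N v by simp
          have "N \<in> monomials_of_degree (n + 1) 2" using N A_sub' S by blast
          hence "N - {#v#} \<in> ?V" using vN in_diffD[of _ N]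
            by (fastforce simp: monomials_of_degree_def size_Diff_singleton)
          moreover have "M - {#v#} = add_mset z (N - {#v#})" using N False by auto
          ultimately show ?thesis by auto
        qed
      qed
    next
      fix v assume "v \<in> {1..n + 1}"
      thus "\<exists>M\<in>?A. v \<in># M" by (rule A_covers')
    next
      fix M assume M: "M \<in> ?A"
      show "\<exists>N\<in>?B. M \<subseteq># N"
      proof (cases "M \<in> A")
        case True
        thus ?thesis by (intro bexI[of _ "add_mset z M"]) auto
      next
        case False
        then obtain w where w: "w \<in> {1..n + 1}" "M = {#z, w#}"
          using M by (auto simp: monomials_of_degree_1 simp del: One_nat_def)
        have sub: "\<exists>N\<in>?B. M \<subseteq># N" if "{#z, w'#} \<in> S" "w' = w \<or> w = z" for w'
          using that w by (intro bexI[of _ "{#z, z, w'#}"]) (auto simp: subseteq_mset_def)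
        \<comment> \<open>The quadric \<open>z w\<close> divides \<open>z^2 w\<close> if
          \<open>w\<close> is in \<open>T\<close>; \<open>z^2\<close> divides \<open>z^2 t\<close>
          for any \<open>t\<close> in the nonempty set \<open>T\<close>. Otherwise \<open>q\<close>
          is positive, since for \<open>q = 0\<close> the set \<open>T\<close> contains all old
          variables, and \<open>z\<close> times a quadric of \<open>A\<close> containing
          \<open>w\<close> does.\<close>
        consider "w \<in> T" | "w = z" | "w \<notin> T" "w \<in> {1..n}"
          using w by (fastforce simp: z_def)
        thus ?thesis
        proof cases
          case 1 thus ?thesis using sub[of w] by (auto simp: S_def)
        next
          case 2
          obtain t where "t \<in> T" using T by blast
          thus ?thesis using 2 sub[of t] by (auto simp: S_def)
        next
          case 3
          hence "A \<noteq> {}" using T card by fastforce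
          then obtain N where "N \<in> A" "w \<in># N" using A_covers 3 by blast
          thus ?thesis using w by (intro bexI[of _ "add_mset z N"]) auto
        qed
      qed
    qed
    thus ?thesis using card_B' by blast
  qed
  thus ?thesis using card_A' by (auto simp: has_cubic_ideal_def)
qed

section \<open>Sets with at most one element from each class\<close>

text \<open>For fixed \<open>E\<close> and varying \<open>k\<close> these are the independent sets
  of the partition matroid whose blocks are the fibres of \<open>\<kappa>\<close> on
  \<open>E\<close>.\<close>

definition rainbow_sets :: "('a \<Rightarrow> 'b) \<Rightarrow> 'a set \<Rightarrow> nat \<Rightarrow> 'a set set" where
  "rainbow_sets \<kappa> E k = {F. F \<subseteq> E \<and> card F = k \<and> inj_on \<kappa> F}"

abbreviation rainbow_count :: "('a \<Rightarrow> 'b) \<Rightarrow> 'a set \<Rightarrow> nat \<Rightarrow> int" where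
  "rainbow_count \<kappa> E k \<equiv> int (card (rainbow_sets \<kappa> E k))"

lemma finite_rainbow_sets: "finite E \<Longrightarrow> finite (rainbow_sets \<kappa> E k)"
  unfolding rainbow_sets_def by (rule finite_subset[of _ "Pow E"]) auto

lemma rainbow_pairI:
  "a \<in> E \<Longrightarrow> b \<in> E \<Longrightarrow> \<kappa> a \<noteq> \<kappa> b \<Longrightarrow> {a, b} \<in> rainbow_sets \<kappa> E 2"
  unfolding rainbow_sets_def by (auto simp: card_insert_if)

lemma rainbow_pairE:
  assumes "F \<in> rainbow_sets \<kappa> E 2"
  obtains a b where "F = {a, b}" "a \<in> E" "b \<in> E" "\<kappa> a \<noteq> \<kappa> b"
proof -
  obtain a b where F: "F = {a, b}" "a \<noteq> b"
    using assms unfolding rainbow_sets_def card_2_iff by blast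
  have "F \<subseteq> E" "inj_on \<kappa> F" using assms by (simp_all add: rainbow_sets_def)
  thus ?thesis using F inj_onD[of \<kappa> F a b] that by blast
qed

lemma rainbow_setsD:
  assumes "F \<in> rainbow_sets \<kappa> E k"
  shows "F \<subseteq> E" "card F = k" "inj_on \<kappa> F"
  using assms by (simp_all add: rainbow_sets_def)

lemma rainbow_sets_mono: "E \<subseteq> E' \<Longrightarrow> rainbow_sets \<kappa> E k \<subseteq> rainbow_sets \<kappa> E' k"
  by (auto simp: rainbow_sets_def)

lemma rainbow_count_1: "rainbow_count \<kappa> E 1 = int (card E)"
proof -
  have "rainbow_sets \<kappa> E 1 = (\<lambda>e. {e}) ` E"
    by (auto simp: rainbow_sets_def card_1_singleton_iff)
  thus ?thesis by (simp add: card_image)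
qed

text \<open>A rainbow set either avoids the fibre \<open>P\<close> or has exactly one element in it,
  and that element can be chosen independently of the rest.\<close>

lemma rainbow_count_remove_class:
  assumes "finite E" and P: "P = {e \<in> E. \<kappa> e = i}"
  shows "rainbow_count \<kappa> E (Suc k) =
           rainbow_count \<kappa> (E - P) (Suc k) + int (card P) * rainbow_count \<kappa> (E - P) k"
proof -
  let ?ins = "\<lambda>(a, F). insert a F" and ?S = "P \<times> rainbow_sets \<kappa> (E - P) k"
  have split: "rainbow_sets \<kappa> E (Suc k) = rainbow_sets \<kappa> (E - P) (Suc k) \<union> ?ins ` ?S"
  proof (intro equalityI subsetI)
    fix F assume F: "F \<in> rainbow_sets \<kappa> E (Suc k)"
    show "F \<in> rainbow_sets \<kappa> (E - P) (Suc k) \<union> ?ins ` ?S"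
    proof (cases "F \<inter> P = {}")
      case True thus ?thesis using F by (auto simp: rainbow_sets_def)
    next
      case False
      then obtain a where a: "a \<in> F" "a \<in> P" by blast
      have F': "F \<subseteq> E" "card F = Suc k" "inj_on \<kappa> F" using F by (simp_all add: rainbow_sets_def)
      have "b = a" if "b \<in> F" "b \<in> P" for b
      proof (rule inj_onD[OF F'(3)])
        show "\<kappa> b = \<kappa> a" using that a by (simp add: P)
      qed fact+
      hence "F - {a} \<subseteq> E - P" using F' by blast
      moreover have "inj_on \<kappa> (F - {a})" using F'(3) by (rule inj_on_subset) blast
      ultimately have "F - {a} \<in> rainbow_sets \<kappa> (E - P) k"
        using F' a by (simp add: rainbow_sets_def)
      thus ?thesis using a by (intro UnI2 image_eqI[of _ _ "(a, F - {a})"]) auto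
    qed
  next
    fix F assume "F \<in> rainbow_sets \<kappa> (E - P) (Suc k) \<union> ?ins ` ?S"
    thus "F \<in> rainbow_sets \<kappa> E (Suc k)"
    proof
      assume "F \<in> ?ins ` ?S"
      then obtain a G where aG: "a \<in> P" "G \<in> rainbow_sets \<kappa> (E - P) k" "F = insert a G" by auto
      moreover have "finite G" using aG(2) finite_subset[OF _ assms(1), of G] by (auto simp: rainbow_sets_def)
      ultimately show ?thesis by (auto simp: rainbow_sets_def P card_insert_if)
    qed (auto simp: rainbow_sets_def)
  qed
  have "inj_on ?ins ?S"
  proof (rule inj_on_inverseI)
    fix x assume "x \<in> ?S"
    then obtain a F where x: "x = (a, F)" "a \<in> P" "F \<subseteq> E - P"
      by (auto simp: rainbow_sets_def)
    hence "F \<inter> P = {}" "F - P = F" by blast+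
    thus "(\<lambda>G. (the_elem (G \<inter> P), G - P)) (?ins x) = x" using x by simp
  qed
  hence "card (?ins ` ?S) = card P * card (rainbow_sets \<kappa> (E - P) k)"
    by (simp add: card_image card_cartesian_product)
  moreover have "rainbow_sets \<kappa> (E - P) (Suc k) \<inter> ?ins ` ?S = {}"
    by (auto simp: rainbow_sets_def)
  moreover have "finite P" using assms by simp
  ultimately show ?thesis
    unfolding split using assms(1)
    by (subst card_Un_disjoint) (auto simp: finite_rainbow_sets)
qed

text \<open>The class size is written \<open>Suc s\<close> because a class of this size corresponds
  to \<open>s\<close> mutually exclusive variables.\<close>

lemma rainbow_remove_class:
  assumes "finite E" "card (\<kappa> ` E) = Suc j"
  obtains E' s where "finite E'" "card (\<kappa> ` E') = j" "card E = card E' + Suc s"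
    "rainbow_count \<kappa> E 2 = rainbow_count \<kappa> E' 2 + int (Suc s) * int (card E')"
    "rainbow_count \<kappa> E 3 = rainbow_count \<kappa> E' 3 + int (Suc s) * rainbow_count \<kappa> E' 2"
proof -
  obtain e where e: "e \<in> E" using assms(2) by fastforce
  define P where "P = {x \<in> E. \<kappa> x = \<kappa> e}"
  have img: "\<kappa> ` (E - P) = \<kappa> ` E - {\<kappa> e}" by (auto simp: P_def)
  have "card (\<kappa> ` (E - P)) = j" unfolding img using assms e by simp
  have P: "P \<subseteq> E" "finite P" using assms(1) by (auto simp: P_def)
  hence "card P \<noteq> 0" using e by (auto simp: P_def)
  then obtain s where s: "card P = Suc s" by (cases "card P") auto
  show ?thesis
  proof (rule that)
    show "finite (E - P)" using assms(1) by simp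
    show "card (\<kappa> ` (E - P)) = j" by fact
    show "card E = card (E - P) + Suc s"
      using card_Diff_subset[OF P(2,1)] card_mono[OF assms(1) P(1)] s by simp
    show "rainbow_count \<kappa> E 2 = rainbow_count \<kappa> (E - P) 2 + int (Suc s) * int (card (E - P))"
      using rainbow_count_remove_class[OF assms(1) P_def, of 1]
      unfolding rainbow_count_1 s Suc_1 .
    show "rainbow_count \<kappa> E 3 = rainbow_count \<kappa> (E - P) 3 + int (Suc s) * rainbow_count \<kappa> (E - P) 2"
      using rainbow_count_remove_class[OF assms(1) P_def, of 2]
      unfolding s by (simp only: eval_nat_numeral)
  qed
qed

text \<open>
  The sets meeting every class at most once form a matroid complex of rank \<open>j\<close> with \<open>h\<close>-polynomial
  the product of the \<open>1 + (p - 1) t\<close> over the class sizes \<open>p\<close>; multiplied by \<open>2\<close> and \<open>6\<close> to clear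
  the denominators of the binomial coefficients, the two equations are those for \<open>h\<^sub>2\<close> and \<open>h\<^sub>3\<close>.
\<close>

lemma has_cubic_ideal_rainbow_le_4:
  assumes "finite E" "card (\<kappa> ` E) = j" "j \<le> 4"
  shows "\<exists>n q c. has_cubic_ideal n q c \<and> card E = n + j \<and>
           2 * int q = 2 * rainbow_count \<kappa> E 2 - 2 * (int j - 1) * int (card E) + int j * (int j - 1) \<and>
           6 * int c = 6 * rainbow_count \<kappa> E 3 - 6 * (int j - 2) * rainbow_count \<kappa> E 2
             + 3 * (int j - 1) * (int j - 2) * int (card E) - int j * (int j - 1) * (int j - 2)"
  using assms
proof (induction j arbitrary: E)
  case 0
  hence "E = {}" by simp
  hence "rainbow_sets \<kappa> E 2 = {}" "rainbow_sets \<kappa> E 3 = {}" by (auto simp: rainbow_sets_def)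
  thus ?case using has_cubic_ideal_0 \<open>E = {}\<close> by (intro exI[of _ 0]) auto
next
  case (Suc j)
  obtain E' s where E': "finite E'" "card (\<kappa> ` E') = j" "card E = card E' + Suc s"
    "rainbow_count \<kappa> E 2 = rainbow_count \<kappa> E' 2 + int (Suc s) * int (card E')"
    "rainbow_count \<kappa> E 3 = rainbow_count \<kappa> E' 3 + int (Suc s) * rainbow_count \<kappa> E' 2"
    using rainbow_remove_class[OF Suc.prems(1,2)] by blast
  obtain n q c where IH: "has_cubic_ideal n q c" "card E' = n + j"
      "2 * int q = 2 * rainbow_count \<kappa> E' 2 - 2 * (int j - 1) * int (card E') + int j * (int j - 1)"
      "6 * int c = 6 * rainbow_count \<kappa> E' 3 - 6 * (int j - 2) * rainbow_count \<kappa> E' 2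
         + 3 * (int j - 1) * (int j - 2) * int (card E') - int j * (int j - 1) * (int j - 2)"
    using Suc.IH[OF E'(1,2)] Suc.prems by auto
  have N: "int (card E') = int n + int j" using IH(2) by simp
  have N': "int (card E) = int n + int j + 1 + int s" using IH(2) E'(3) by simp
  show ?case
  proof (intro exI conjI)
    \<comment> \<open>The removed class contributes the factor \<open>1 + s t\<close> of the
      \<open>h\<close>-polynomial.\<close>
    show "has_cubic_ideal (n + s) (q + s * n) (c + s * q)"
      using IH(1) by (rule has_cubic_ideal_exclusive)
    show "card E = n + s + Suc j" using IH E' by simp
    show "2 * int (q + s * n) = 2 * rainbow_count \<kappa> E 2 - 2 * (int (Suc j) - 1) * int (card E)
        + int (Suc j) * (int (Suc j) - 1)"
      using IH(3) unfolding E'(4) N N' of_nat_Suc of_nat_add of_nat_mult of_nat_1 by algebra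
    show "6 * int (c + s * q) = 6 * rainbow_count \<kappa> E 3 - 6 * (int (Suc j) - 2) * rainbow_count \<kappa> E 2
         + 3 * (int (Suc j) - 1) * (int (Suc j) - 2) * int (card E)
         - int (Suc j) * (int (Suc j) - 1) * (int (Suc j) - 2)"
      using IH(3,4) unfolding E'(4,5) N N' of_nat_Suc of_nat_add of_nat_mult of_nat_1 by algebra
  qed
qed

lemma has_cubic_ideal_rainbow_eq_3:
  assumes "finite E" "card (\<kappa> ` E) = 3"
  shows "\<exists>n q c. has_cubic_ideal n q c \<and> card E = n + 3 \<and>
           int q = rainbow_count \<kappa> E 2 - 2 * int (card E) + 3 \<and>
           int c = rainbow_count \<kappa> E 3 - rainbow_count \<kappa> E 2 + int (card E) - 1"
proof -
  obtain n q c where "has_cubic_ideal n q c" "card E = n + 3"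
    "2 * int q = 2 * rainbow_count \<kappa> E 2 - 4 * int (card E) + 6"
    "6 * int c = 6 * rainbow_count \<kappa> E 3 - 6 * rainbow_count \<kappa> E 2 + 6 * int (card E) - 6"
    using has_cubic_ideal_rainbow_le_4[OF assms] by auto
  thus ?thesis by (intro exI[of _ n] exI[of _ q] exI[of _ c] conjI) linarith+
qed

text \<open>The right-hand sides are \<open>h_1\<close>, \<open>h_2\<close>, \<open>h_3\<close>
  computed in rank 4. The rank 3 entries are their partial sums, which is the effect of one more
  free variable. That variable is held back so that the number of cubics can be adjusted when it is
  adjoined.\<close>

lemma has_cubic_ideal_rainbow_ge_4:
  assumes "finite E" "card (\<kappa> ` E) = k + 4"
  shows "\<exists>n q c. has_cubic_ideal n q c \<and> card E = n + 4 \<and>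
           int q = rainbow_count \<kappa> E 2 - 3 * int (card E) + 6 \<and>
           int c = rainbow_count \<kappa> E 3 - 2 * rainbow_count \<kappa> E 2 + 3 * int (card E) - 4"
  using assms
proof (induction k arbitrary: E)
  case 0
  obtain n q c where "has_cubic_ideal n q c" "card E = n + 4"
    "2 * int q = 2 * rainbow_count \<kappa> E 2 - 6 * int (card E) + 12"
    "6 * int c = 6 * rainbow_count \<kappa> E 3 - 12 * rainbow_count \<kappa> E 2 + 18 * int (card E) - 24"
    using has_cubic_ideal_rainbow_le_4[of E \<kappa> 4] 0 by auto
  thus ?case by (intro exI[of _ n] exI[of _ q] exI[of _ c] conjI) linarith+
next
  case (Suc k)
  obtain E' s where E': "finite E'" "card (\<kappa> ` E') = k + 4" "card E = card E' + Suc s"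
    "rainbow_count \<kappa> E 2 = rainbow_count \<kappa> E' 2 + int (Suc s) * int (card E')"
    "rainbow_count \<kappa> E 3 = rainbow_count \<kappa> E' 3 + int (Suc s) * rainbow_count \<kappa> E' 2"
    using rainbow_remove_class[of E \<kappa> "k + 4"] Suc.prems by auto
  obtain n q c where IH: "has_cubic_ideal n q c" "card E' = n + 4"
      "int q = rainbow_count \<kappa> E' 2 - 3 * int (card E') + 6"
      "int c = rainbow_count \<kappa> E' 3 - 2 * rainbow_count \<kappa> E' 2 + 3 * int (card E') - 4"
    using Suc.IH[of E'] E' by auto
  have N: "int (card E') = int n + 4" using IH(2) by simp
  have N': "int (card E) = int n + 5 + int s" using IH(2) E'(3) by simp
  have f1: "rainbow_count \<kappa> E' 2 = int q + 3 * int n + 6"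
    using IH(3) N by simp
  have f2: "rainbow_count \<kappa> E' 3 = int c + 2 * int q + 3 * int n + 4"
    using IH(4) N f1 by simp
  \<comment> \<open>Each class beyond the fourth brings a free variable, here with every possible
    cubic kept, and then its exclusive variables.\<close>
  have "has_cubic_ideal (n + 1) (q + n + 1) (q + n + 1 + c)"
  proof (rule has_cubic_ideal_free[OF IH(1)])
    have "c = 0" if "q = 0" using IH(1) that has_cubic_ideal_no_quadratics by blast
    thus "q + n + 1 + c = 0 \<or> (0 < q \<and> q + 1 \<le> q + n + 1 + c \<and> q + n + 1 + c \<le> q + n + 1 + c) \<or>
      (q = 0 \<and> 1 \<le> q + n + 1 + c \<and> n \<le> q + n + 1 + c \<and> q + n + 1 + c \<le> n + 1)" by auto
  qed
  hence "has_cubic_ideal (n + 1 + s) (q + n + 1 + s * (n + 1)) (q + n + 1 + c + s * (q + n + 1))"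
    by (rule has_cubic_ideal_exclusive)
  moreover have "card E = n + 1 + s + 4" using IH E' by simp
  moreover have "int (q + n + 1 + s * (n + 1)) = rainbow_count \<kappa> E 2 - 3 * int (card E) + 6"
    unfolding E'(4) N N' f1 by (simp add: algebra_simps)
  moreover have "int (q + n + 1 + c + s * (q + n + 1))
      = rainbow_count \<kappa> E 3 - 2 * rainbow_count \<kappa> E 2 + 3 * int (card E) - 4"
    unfolding E'(4,5) N N' f2 f1 by (simp add: algebra_simps)
  ultimately show ?case by blast
qed

section \<open>Matroid complexes of rank 3\<close>

lemma h_vector_rank_3:
  assumes "complex_rank \<Delta> = 3"
  defines "\<phi> \<equiv> \<lambda>k. int (card {F \<in> \<Delta>. card F = k})"
  shows "h_vector \<Delta> = [\<phi> 0, \<phi> 1 - 3 * \<phi> 0, \<phi> 2 - 2 * \<phi> 1 + 3 * \<phi> 0, \<phi> 3 - \<phi> 2 + \<phi> 1 - \<phi> 0]"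
proof -
  have f: "int (f_number \<Delta> (int i - 1)) = \<phi> i" for i
    by (simp add: f_number_def face_dim_def \<phi>_def)
  have I: "{0..3::nat} = {0, 1, 2, 3}" and U: "[0..<3 + 1] = [0, 1, 2, 3::nat]" by (auto simp: upt_rec)
  have monom: "monom 1 (Suc 0) = [:0, 1::int:]" "monom 1 2 = [:0, 0, 1::int:]" "monom 1 3 = [:0, 0, 0, 1::int:]"
    by (simp_all add: monom_altdef eval_nat_numeral)
  have pow: "[:1, -1::int:] ^ 3 = [:1, -3, 3, -1:]" "[:1, -1::int:] ^ 2 = [:1, -2, 1:]"
    by (simp_all add: eval_nat_numeral)
  have "h_poly \<Delta> = [:\<phi> 0, \<phi> 1 - 3 * \<phi> 0, \<phi> 2 - 2 * \<phi> 1 + 3 * \<phi> 0, \<phi> 3 - \<phi> 2 + \<phi> 1 - \<phi> 0:]"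
    unfolding h_poly_def assms(1) f I
    by (simp add: monom pow monom_0 algebra_simps)
  thus ?thesis unfolding h_vector_def assms(1) U by (simp add: numeral_2_eq_2 numeral_3_eq_3)
qed

locale matroid_rank_3 =
  fixes V :: "'a set" and \<Delta> :: "'a set set"
  assumes matroid: "matroid_complex V \<Delta>" and rank: "complex_rank \<Delta> = 3"
begin

lemma finite_V: "finite V" and faces_subset: "\<Delta> \<subseteq> Pow V" and empty_face: "{} \<in> \<Delta>"
  and face_subset: "F \<in> \<Delta> \<Longrightarrow> G \<subseteq> F \<Longrightarrow> G \<in> \<Delta>"
  using matroid by (auto simp: matroid_complex_def simplicial_complex_def)

lemma finite_faces: "finite \<Delta>"
  using finite_V faces_subset finite_subset by blast

lemma finite_face: "F \<in> \<Delta> \<Longrightarrow> finite F"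
  using finite_V faces_subset finite_subset by blast

text \<open>The exchange property comes from purity of the restriction to
  \<open>A \<union> B\<close>: a maximal face above \<open>A\<close> there has at least
  \<open>card B\<close> elements, so it is larger than \<open>A\<close>, and what it adds lies in
  \<open>B\<close>.\<close>

lemma augment:
  assumes "A \<in> \<Delta>" "B \<in> \<Delta>" "card A < card B"
  obtains x where "x \<in> B" "x \<notin> A" "insert x A \<in> \<Delta>"
proof -
  define R where "R = complex_restrict \<Delta> (A \<union> B)"
  have "A \<union> B \<subseteq> V" using assms faces_subset by blast
  hence pure: "pure_complex R" using matroid by (simp add: R_def matroid_complex_def)
  have fin: "finite R" using finite_faces by (simp add: R_def complex_restrict_def)
  have AB: "A \<in> R" "B \<in> R" using assms by (auto simp: R_def complex_restrict_def)
  have "\<exists>M\<in>maximal_faces R. X \<subseteq> M" if "X \<in> R" for X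
    using finite_has_maximal2[OF fin that] by (auto simp: maximal_faces_def)
  then obtain M N where M: "M \<in> maximal_faces R" "A \<subseteq> M" and N: "N \<in> maximal_faces R" "B \<subseteq> N"
    using AB by meson
  have MN: "M \<in> \<Delta>" "N \<in> \<Delta>" "M \<subseteq> A \<union> B"
    using M(1) N(1) unfolding maximal_faces_def R_def complex_restrict_def by blast+
  have "card M = card N"
  proof -
    have "face_dim M = face_dim N" using pure M(1) N(1) unfolding pure_complex_def by blast
    thus ?thesis by (simp add: face_dim_def)
  qed
  also have "card N \<ge> card B" using N(2) finite_face[OF MN(2)] by (simp add: card_mono)
  finally have "M \<noteq> A" using assms by auto
  then obtain x where "x \<in> M" "x \<notin> A" using M by blast
  thus ?thesis using that[of x] MN M face_subset[of M "insert x A"] by blast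
qed

lemma ex_basis: obtains B where "B \<in> \<Delta>" "card B = 3"
proof -
  have "Max (face_dim ` \<Delta>) = 2" using rank by (auto simp: complex_rank_def complex_dim_def)
  moreover have "Max (face_dim ` \<Delta>) \<in> face_dim ` \<Delta>"
    using finite_faces empty_face by (intro Max_in) auto
  ultimately obtain B where "B \<in> \<Delta>" "card B = 3" by (auto simp: face_dim_def)
  thus ?thesis by (rule that)
qed

section \<open>Points and their parallel classes\<close>

definition points :: "'a set" where
  "points = {e. {e} \<in> \<Delta>}"

text \<open>As a map from points to sets it plays the role of \<open>\<kappa>\<close> in the rainbow
  counts.\<close>

definition parallel_class :: "'a \<Rightarrow> 'a set" where
  "parallel_class v = {w \<in> points. w = v \<or> {v, w} \<notin> \<Delta>}"

lemma finite_points: "finite points"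
  using faces_subset by (intro finite_subset[OF _ finite_V]) (auto simp: points_def)

lemma face_points: "F \<in> \<Delta> \<Longrightarrow> F \<subseteq> points"
  using face_subset by (auto simp: points_def)

text \<open>Read contrapositively, this is transitivity of parallelism; it is the exchange property
  for \<open>{v}\<close> and \<open>{u, w}\<close>.\<close>

lemma parallel_trans:
  assumes "v \<in> points" "u \<noteq> w" "{u, w} \<in> \<Delta>" "v \<noteq> u" "v \<noteq> w"
  shows "{v, u} \<in> \<Delta> \<or> {v, w} \<in> \<Delta>"
proof -
  have "card {v} < card {u, w}" using assms by simp
  then obtain x where "x \<in> {u, w}" "insert x {v} \<in> \<Delta>"
    using augment[of "{v}" "{u, w}"] assms by (auto simp: points_def)
  thus ?thesis by (auto simp: insert_commute)
qed

lemma parallel_class_eq_iff: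
  assumes "v \<in> points" "w \<in> points"
  shows "parallel_class v = parallel_class w \<longleftrightarrow> v = w \<or> {v, w} \<notin> \<Delta>"
proof
  assume "parallel_class v = parallel_class w"
  moreover have "w \<in> parallel_class w" using assms by (simp add: parallel_class_def)
  ultimately show "v = w \<or> {v, w} \<notin> \<Delta>" by (auto simp: parallel_class_def)
next
  have sub: "parallel_class v \<subseteq> parallel_class w"
    if "v \<in> points" "w \<in> points" "v \<noteq> w" "{v, w} \<notin> \<Delta>" for v w
  proof
    fix u assume "u \<in> parallel_class v"
    hence u: "u \<in> points" "u = v \<or> {v, u} \<notin> \<Delta>" by (auto simp: parallel_class_def)
    have "{w, u} \<notin> \<Delta>" if "u \<noteq> w"
    proof (cases "u = v")
      case True thus ?thesis using \<open>{v, w} \<notin> \<Delta>\<close> by (simp add: insert_commute)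
    next
      case False
      hence "{v, u} \<notin> \<Delta>" using u by blast
      hence "{u, w} \<notin> \<Delta>"
        using parallel_trans[OF \<open>v \<in> points\<close> \<open>u \<noteq> w\<close>] False \<open>v \<noteq> w\<close> \<open>{v, w} \<notin> \<Delta>\<close> by blast
      thus ?thesis by (simp add: insert_commute)
    qed
    thus "u \<in> parallel_class w" using u(1) by (auto simp: parallel_class_def)
  qed
  assume "v = w \<or> {v, w} \<notin> \<Delta>"
  thus "parallel_class v = parallel_class w"
    using sub[of v w] sub[of w v] assms insert_commute[of v w "{}"] by fastforce
qed

lemma inj_on_parallel_class_face:
  assumes "F \<in> \<Delta>"
  shows "inj_on parallel_class F"
proof (rule inj_onI)
  fix v w assume vw: "v \<in> F" "w \<in> F" "parallel_class v = parallel_class w"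
  have "v \<in> points" "w \<in> points" using vw face_points[OF assms] by blast+
  moreover have "{v, w} \<in> \<Delta>" using vw by (intro face_subset[OF assms]) simp
  ultimately show "v = w" using parallel_class_eq_iff vw(3) by metis
qed

lemma faces_rainbow: "{F \<in> \<Delta>. card F = k} \<subseteq> rainbow_sets parallel_class points k"
  unfolding rainbow_sets_def
proof clarify
  fix F assume "F \<in> \<Delta>"
  thus "F \<subseteq> points \<and> card F = card F \<and> inj_on parallel_class F"
    using inj_on_parallel_class_face face_points by simp
qed

lemma pair_face:
  assumes "v \<in> points" "w \<in> points" "parallel_class v \<noteq> parallel_class w"
  shows "{v, w} \<in> \<Delta>"
  using parallel_class_eq_iff[OF assms(1,2)] assms(3) by simp

lemma rainbow_pairs_face:
  assumes "F \<in> rainbow_sets parallel_class points 2"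
  shows "F \<in> \<Delta>"
proof -
  obtain v w where F: "F = {v, w}" and "v \<in> points" "w \<in> points" "parallel_class v \<noteq> parallel_class w"
    using assms by (rule rainbow_pairE)
  thus ?thesis unfolding F by (intro pair_face)
qed

lemma rainbow_pairs: "rainbow_sets parallel_class points 2 = {F \<in> \<Delta>. card F = 2}"
proof
  show "rainbow_sets parallel_class points 2 \<subseteq> {F \<in> \<Delta>. card F = 2}"
    using rainbow_pairs_face rainbow_setsD(2) by blast
qed (rule faces_rainbow)

abbreviation "N \<equiv> int (card points)"
abbreviation "pairs E \<equiv> rainbow_count parallel_class E 2"
abbreviation "triples \<equiv> rainbow_count parallel_class points 3"
abbreviation "bases \<equiv> {F \<in> \<Delta>. card F = 3}"

text \<open>Pairs are faces exactly when they are rainbow, so only the last entry sees more of the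
  matroid than its class sizes.\<close>

lemma h_vector_eq:
  "h_vector \<Delta> = [1, N - 3, pairs points - 2 * N + 3, int (card bases) - pairs points + N - 1]"
proof -
  have "F = {}" if "F \<in> \<Delta>" "card F = 0" for F using finite_face[OF that(1)] that(2) by simp
  hence "{F \<in> \<Delta>. card F = 0} = {{}}" using empty_face by (intro equalityI subsetI) simp_all
  moreover have "{F \<in> \<Delta>. card F = 1} = (\<lambda>e. {e}) ` points"
    by (auto simp: points_def card_1_singleton_iff)
  hence "int (card {F \<in> \<Delta>. card F = 1}) = N" by (simp add: card_image)
  ultimately show ?thesis unfolding h_vector_rank_3[OF rank] rainbow_pairs by simp
qed

lemma card_bases_le: "int (card bases) \<le> triples"
  using card_mono[OF finite_rainbow_sets[OF finite_points] faces_rainbow] by simp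

lemma card_classes_ge: "card (parallel_class ` points) \<ge> 3"
proof -
  obtain B where B: "B \<in> \<Delta>" "card B = 3" by (rule ex_basis)
  have "card B = card (parallel_class ` B)" using inj_on_parallel_class_face[OF B(1)] by (simp add: card_image)
  also have "\<dots> \<le> card (parallel_class ` points)"
    using finite_points face_points[OF B(1)] by (intro card_mono) auto
  finally show ?thesis using B by simp
qed

lemma extend_pair:
  assumes "{a, b} \<in> \<Delta>"
  obtains x where "x \<notin> {a, b}" "{x, a, b} \<in> \<Delta>"
proof -
  obtain B where B: "B \<in> \<Delta>" "card B = 3" by (rule ex_basis)
  have "card {a, b} < card B" using B by (auto simp: card_insert_if)
  thus ?thesis using augment[OF assms B(1)] that by (metis)
qed

text \<open>A basis through \<open>a\<close> and \<open>b\<close> must take its third element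
  \<open>x\<close> from the class of \<open>c\<close>; exchanging with \<open>{a, c}\<close> then
  replaces \<open>x\<close> by \<open>c\<close>.\<close>

lemma triples_faces_3_classes:
  assumes "card (parallel_class ` points) = 3" "F \<in> rainbow_sets parallel_class points 3"
  shows "F \<in> \<Delta>"
proof -
  obtain a b c where F: "F = {a, b, c}" "a \<noteq> b" "b \<noteq> c" "a \<noteq> c"
    using rainbow_setsD(2)[OF assms(2)] unfolding card_3_iff by blast
  note inj = rainbow_setsD(3)[OF assms(2)]
  have pts: "a \<in> points" "b \<in> points" "c \<in> points"
    using rainbow_setsD(1)[OF assms(2)] F(1) by simp_all
  have ne: "parallel_class a \<noteq> parallel_class b" "parallel_class a \<noteq> parallel_class c"
    using inj_onD[OF inj, of a] F by blast+
  obtain x where x: "x \<notin> {a, b}" "{x, a, b} \<in> \<Delta>" using extend_pair pair_face[OF pts(1,2) ne(1)] by blast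
  have xp: "x \<in> points" using x face_points by blast
  have xne: "parallel_class x \<noteq> parallel_class a" "parallel_class x \<noteq> parallel_class b"
    using inj_onD[OF inj_on_parallel_class_face[OF x(2)], of x] x(1) by blast+
  have "card (parallel_class ` F) = 3" using inj rainbow_setsD(2)[OF assms(2)] by (simp add: card_image)
  hence "parallel_class ` F = parallel_class ` points"
    using assms(1) finite_points rainbow_setsD(1)[OF assms(2)] by (intro card_subset_eq) auto
  hence "parallel_class x \<in> parallel_class ` F" using xp by blast
  hence xc: "parallel_class x = parallel_class c" using xne F by auto
  show ?thesis
  proof (cases "x = c")
    case True thus ?thesis using x F by (simp add: insert_commute)
  next
    case False
    have "card {a, c} < card {x, a, b}" using F x by auto
    then obtain y where y: "y \<in> {x, a, b}" "y \<notin> {a, c}" "insert y {a, c} \<in> \<Delta>"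
      using augment[OF pair_face[OF pts(1,3) ne(2)] x(2)] by metis
    \<comment> \<open>\<open>x\<close> and \<open>c\<close> are parallel, so no face contains both;
      this leaves \<open>y = b\<close>.\<close>
    have "y \<noteq> x"
    proof
      assume "y = x"
      hence "{x, c} \<in> \<Delta>" using face_subset[OF y(3), of "{x, c}"] by blast
      thus False using parallel_class_eq_iff[OF xp pts(3)] xc False by blast
    qed
    thus ?thesis using y F by (auto simp: insert_commute)
  qed
qed

end

section \<open>The line through a collinear triple\<close>

locale collinear_triple = matroid_rank_3 +
  fixes x y z
  assumes xyz: "{x, y, z} \<in> rainbow_sets parallel_class points 3" and collinear: "{x, y, z} \<notin> \<Delta>"
begin

text \<open>This is the flat spanned by \<open>x\<close> and \<open>y\<close>, without loops. Points
  parallel to \<open>x\<close> or \<open>y\<close> belong to it as well, since they form no basis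
  with the two.\<close>

definition line :: "'a set" where
  "line = {e \<in> points. e \<in> {x, y} \<or> {e, x, y} \<notin> \<Delta>}"

definition off :: "'a set" where
  "off = points - line"

lemma distinct: "x \<noteq> y" "x \<noteq> z" "y \<noteq> z"
  using xyz by (auto simp: rainbow_sets_def card_insert_if split: if_splits)

lemma xyz_line: "x \<in> line" "y \<in> line" "z \<in> line"
  using rainbow_setsD(1)[OF xyz] collinear insert_commute[of z x] insert_commute[of z y]
  by (simp_all add: line_def)

lemma xyz_classes: "parallel_class x \<noteq> parallel_class y" "parallel_class x \<noteq> parallel_class z"
    "parallel_class y \<noteq> parallel_class z"
  using inj_onD[OF rainbow_setsD(3)[OF xyz]] distinct by blast+

lemma line_points: "line \<subseteq> points" and off_points: "off \<subseteq> points"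
  by (auto simp: line_def off_def)

lemma finite_line: "finite line" and finite_off: "finite off"
  using line_points off_points finite_points finite_subset by blast+

lemma offD: "c \<in> off \<Longrightarrow> c \<notin> {x, y} \<and> {c, x, y} \<in> \<Delta>"
  by (auto simp: off_def line_def)

lemma xy_face: "{x, y} \<in> \<Delta>"
  using pair_face xyz_line line_points xyz_classes by blast

text \<open>Such a basis would extend \<open>{x, y}\<close> by one of its own elements, which would
  then lie off the line.\<close>

lemma basis_not_subset_line:
  assumes "B \<in> \<Delta>" "card B = 3"
  shows "\<not> B \<subseteq> line"
proof
  assume sub: "B \<subseteq> line"
  have "card {x, y} < card B" using assms distinct by simp
  then obtain e where "e \<in> B" "e \<notin> {x, y}" "insert e {x, y} \<in> \<Delta>"
    using augment[OF xy_face assms(1)] by metis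
  thus False using sub by (auto simp: line_def)
qed

text \<open>Exchange \<open>p\<close> with the basis \<open>{c, x, y}\<close>: adding
  \<open>x\<close> or \<open>y\<close> would produce a basis inside the line, so \<open>c\<close> is
  added.\<close>

lemma basis_line_off:
  assumes "p \<in> rainbow_sets parallel_class line 2" "c \<in> off"
  shows "insert c p \<in> \<Delta> \<and> card (insert c p) = 3"
proof -
  have p: "p \<in> \<Delta>" "card p = 2" "p \<subseteq> line"
    using rainbow_pairs_face rainbow_sets_mono[OF line_points] rainbow_setsD[OF assms(1)] assms(1) by blast+
  have "card p < card {c, x, y}" using offD[OF assms(2)] p distinct by simp
  then obtain e where e: "e \<in> {c, x, y}" "e \<notin> p" "insert e p \<in> \<Delta>"
    using augment[OF p(1)] offD[OF assms(2)] by metis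
  have card: "card (insert e p) = 3" using e p finite_face[OF p(1)] by simp
  hence "\<not> insert e p \<subseteq> line" using e by (intro basis_not_subset_line)
  hence "e = c" using e p xyz_line by blast
  thus ?thesis using e card by simp
qed

text \<open>\<open>a\<close> cannot be parallel to both \<open>x\<close> and \<open>y\<close>; with
  the other one it forms a pair to which \<open>c\<close> can be added.\<close>

lemma line_off_face:
  assumes "a \<in> line" "c \<in> off"
  shows "{a, c} \<in> \<Delta>"
proof -
  obtain b where b: "b \<in> {x, y}" "parallel_class a \<noteq> parallel_class b"
    using xyz_classes(1) by (metis insertCI)
  hence "{a, b} \<in> rainbow_sets parallel_class line 2"
    using assms xyz_line by (intro rainbow_pairI) auto
  hence "insert c {a, b} \<in> \<Delta>" using basis_line_off assms by blast
  thus ?thesis by (rule face_subset) auto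
qed

text \<open>Any two of the three points form a basis with an element \<open>c\<close> of
  \<open>g\<close>. Exchange adds one of these two to \<open>g\<close>, so at most one of the three
  points fails.\<close>

lemma off_pair_complements:
  assumes "g \<in> rainbow_sets parallel_class off 2"
  shows "card {a \<in> {x, y, z}. insert a g \<in> \<Delta>} \<ge> 2"
proof -
  have g: "g \<in> \<Delta>" "card g = 2" "g \<subseteq> off"
    using rainbow_pairs_face rainbow_sets_mono[OF off_points] rainbow_setsD[OF assms] assms by blast+
  obtain c where c: "c \<in> g" using g by (auto simp: card_2_iff)
  have one: "insert a g \<in> \<Delta> \<or> insert b g \<in> \<Delta>"
    if "a \<in> {x, y, z}" "b \<in> {x, y, z}" "a \<noteq> b" for a b
  proof -
    have "{a, b} \<in> rainbow_sets parallel_class line 2"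
      using that xyz_line xyz_classes by (intro rainbow_pairI) auto
    hence *: "insert c {a, b} \<in> \<Delta>" "card (insert c {a, b}) = 3" using basis_line_off c g by blast+
    obtain e where "e \<in> insert c {a, b}" "e \<notin> g" "insert e g \<in> \<Delta>"
      using augment[OF g(1) *(1)] *(2) g(2) by (metis lessI numeral_2_eq_2 numeral_3_eq_3)
    thus ?thesis using c by auto
  qed
  obtain a b where "{a, b} \<subseteq> {a \<in> {x, y, z}. insert a g \<in> \<Delta>}" "a \<noteq> b"
    using one[of x y] one[of x z] one[of y z] distinct by blast
  hence "card {a, b} \<le> card {a \<in> {x, y, z}. insert a g \<in> \<Delta>}" by (intro card_mono) auto
  thus ?thesis using \<open>a \<noteq> b\<close> by simp
qed

section \<open>Counting pairs and bases by their position relative to the line\<close>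

abbreviation "h \<equiv> int (card line)"
abbreviation "k \<equiv> int (card off)"

lemma card_points: "N = h + k"
proof -
  have "points = line \<union> off" "line \<inter> off = {}" using line_points by (auto simp: off_def)
  thus ?thesis using card_Un_disjoint[OF finite_line finite_off] by simp
qed

text \<open>A point on the line is never parallel to a point off it, so every mixed pair
  counts.\<close>

lemma pairs_points: "pairs points = pairs line + h * k + pairs off"
proof -
  let ?M = "(\<lambda>(a, c). {a, c}) ` (line \<times> off)"
  let ?r = "\<lambda>E. rainbow_sets parallel_class E 2"
  have disj: "line \<inter> off = {}" and un: "points = line \<union> off" using line_points by (auto simp: off_def)
  have "?r points = ?r line \<union> ?r off \<union> ?M"
  proof (intro equalityI subsetI)
    fix F assume "F \<in> ?r points"
    then obtain a b where F: "F = {a, b}" "a \<in> points" "b \<in> points" "parallel_class a \<noteq> parallel_class b"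
      by (rule rainbow_pairE)
    have M: "{c, d} \<in> ?M" if "c \<in> line" "d \<in> off" for c d using that by auto
    consider "a \<in> line" "b \<in> line" | "a \<in> off" "b \<in> off" | "a \<in> line" "b \<in> off" | "b \<in> line" "a \<in> off"
      using F un by blast
    thus "F \<in> ?r line \<union> ?r off \<union> ?M"
      unfolding F(1) using rainbow_pairI[of _ _ _ parallel_class] F(4) M[of a b] M[of b a]
      by cases (simp_all add: insert_commute)
  next
    fix F assume F: "F \<in> ?r line \<union> ?r off \<union> ?M"
    show "F \<in> ?r points"
    proof (cases "F \<in> ?M")
      case True
      then obtain a c where ac: "F = {a, c}" "a \<in> line" "c \<in> off" by auto
      hence "a \<noteq> c" using disj by blast
      hence "card F = 2" using ac by simp
      thus ?thesis using ac line_off_face[of a c] by (simp add: rainbow_pairs)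
    qed (use F rainbow_sets_mono[OF line_points] rainbow_sets_mono[OF off_points] in blast)
  qed
  moreover have "card ?M = card line * card off"
  proof -
    have "inj_on (\<lambda>(a, c). {a, c}) (line \<times> off)"
      using disj by (auto simp: inj_on_def doubleton_eq_iff)
    thus ?thesis by (simp add: card_image card_cartesian_product)
  qed
  moreover have "?r line \<inter> ?r off = {}"
  proof (intro equals0I)
    fix F assume "F \<in> ?r line \<inter> ?r off"
    hence "F \<subseteq> line \<inter> off" "card F = 2" using rainbow_setsD by blast+
    thus False using disj by simp
  qed
  moreover have "(?r line \<union> ?r off) \<inter> ?M = {}"
    using disj rainbow_setsD(1)[of _ parallel_class line] rainbow_setsD(1)[of _ parallel_class off]
    by blast
  ultimately show ?thesis
    using finite_line finite_off by (simp add: card_Un_disjoint finite_rainbow_sets)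
qed

text \<open>The two summands bound the bases with exactly one and exactly two elements off the line;
  bases entirely off the line are ignored.\<close>

lemma card_bases_ge: "int (card bases) \<ge> k * pairs line + 2 * pairs off"
proof -
  let ?r = "\<lambda>E. rainbow_sets parallel_class E 2"
  let ?ins = "\<lambda>(c, p). insert c p" and ?ins' = "\<lambda>(g, a). insert a g"
  define comp where "comp g = {a \<in> {x, y, z}. insert a g \<in> \<Delta>}" for g
  have disj: "line \<inter> off = {}" by (auto simp: off_def)
  have fin: "finite (?r line)" "finite (?r off)" using finite_line finite_off by (simp_all add: finite_rainbow_sets)
  have comp: "comp g \<subseteq> line" "finite (comp g)" for g using xyz_line by (auto simp: comp_def)
  have "inj_on ?ins (off \<times> ?r line)"
  proof (rule inj_on_inverseI)
    fix t assume "t \<in> off \<times> ?r line"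
    then obtain c p where cp: "t = (c, p)" "c \<in> off" "p \<in> ?r line" by blast
    have "insert c p \<inter> off = {c}" "insert c p \<inter> line = p"
      using cp disj rainbow_setsD(1)[OF cp(3)] by blast+
    \<comment> \<open>Intersecting with \<open>line\<close> and \<open>off\<close> recovers both
      components; the same is done for the second family with the roles exchanged.\<close>
    thus "(\<lambda>F. (the_elem (F \<inter> off), F \<inter> line)) (?ins t) = t"
      unfolding cp(1) by (simp only: prod.case the_elem_eq)
  qed
  hence 1: "card (?ins ` (off \<times> ?r line)) = card off * card (?r line)"
    by (simp add: card_image card_cartesian_product)
  have "inj_on ?ins' (Sigma (?r off) comp)"
  proof (rule inj_on_inverseI)
    fix t assume "t \<in> Sigma (?r off) comp"
    then obtain g a where ga: "t = (g, a)" "g \<in> ?r off" "a \<in> comp g" by blast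
    have "insert a g \<inter> line = {a}" "insert a g \<inter> off = g"
      using ga disj comp rainbow_setsD(1)[OF ga(2)] by blast+
    thus "(\<lambda>F. (F \<inter> off, the_elem (F \<inter> line))) (?ins' t) = t"
      unfolding ga(1) by (simp only: prod.case the_elem_eq)
  qed
  hence "card (?ins' ` Sigma (?r off) comp) = (\<Sum>g\<in>?r off. card (comp g))"
    using fin comp by (simp add: card_image card_SigmaI)
  also have "\<dots> \<ge> (\<Sum>g\<in>?r off. 2)"
    using off_pair_complements by (intro sum_mono) (simp add: comp_def)
  finally have 2: "card (?ins' ` Sigma (?r off) comp) \<ge> 2 * card (?r off)" by simp
  have "card off * card (?r line) + 2 * card (?r off)
      \<le> card (?ins ` (off \<times> ?r line) \<union> ?ins' ` Sigma (?r off) comp)"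
  proof (subst card_Un_disjoint)
    \<comment> \<open>The two families differ in the number of elements off the line.\<close>
    show "?ins ` (off \<times> ?r line) \<inter> ?ins' ` Sigma (?r off) comp = {}"
    proof (intro equals0I)
      fix F assume F: "F \<in> ?ins ` (off \<times> ?r line) \<inter> ?ins' ` Sigma (?r off) comp"
      then obtain c p where cp: "F = insert c p" "c \<in> off" "p \<in> ?r line" by auto
      obtain g a where ga: "F = insert a g" "g \<in> ?r off" "a \<in> comp g" using F by auto
      have "F \<inter> off = {c}" using cp disj rainbow_setsD(1)[OF cp(3)] by blast
      moreover have "F \<inter> off = g" using ga disj comp rainbow_setsD(1)[OF ga(2)] by blast
      ultimately show False using rainbow_setsD(2)[OF ga(2)] by simp
    qed
  qed (use 1 2 fin finite_off comp in auto)
  also have "\<dots> \<le> card bases"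
  proof (rule card_mono)
    have "insert a g \<in> bases" if "g \<in> ?r off" "a \<in> comp g" for g a
    proof -
      have "card g = 2" "g \<subseteq> off" using rainbow_setsD[OF that(1)] by simp_all
      moreover have "a \<notin> g" using that(2) comp disj \<open>g \<subseteq> off\<close> by blast
      moreover have "finite g" using \<open>g \<subseteq> off\<close> finite_off by (rule finite_subset)
      ultimately show ?thesis using that(2) by (simp add: comp_def)
    qed
    thus "?ins ` (off \<times> ?r line) \<union> ?ins' ` Sigma (?r off) comp \<subseteq> bases"
      using basis_line_off by auto
  qed (use finite_faces in auto)
  finally have "int (card off * card (?r line) + 2 * card (?r off)) \<le> int (card bases)" by linarith
  thus ?thesis by simp
qed

section \<open>Bounds on the line and on the last entry of the h-vector\<close>

lemma pairs_line_ge: "pairs line \<ge> 2 * h - 3" and card_line_ge: "h \<ge> 3"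
proof -
  have "card (parallel_class ` {x, y, z}) = 3" using xyz_classes by simp
  hence m: "card (parallel_class ` line) \<ge> 3"
    using card_mono[of "parallel_class ` line" "parallel_class ` {x, y, z}"] finite_line xyz_line by auto
  thus h: "h \<ge> 3" using card_image_le[OF finite_line, of parallel_class] by linarith
  \<comment> \<open>For three classes the difference of the two sides is the number of quadrics of
    an ideal, hence nonnegative. For more classes the same argument gives \<open>3 * h - 6\<close>,
    which is no smaller because \<open>h \<ge> 3\<close>.\<close>
  show "pairs line \<ge> 2 * h - 3"
  proof (cases "card (parallel_class ` line) = 3")
    case True
    thus ?thesis using has_cubic_ideal_rainbow_eq_3[OF finite_line True] by auto
  next
    case False
    hence "card (parallel_class ` line) = (card (parallel_class ` line) - 4) + 4" using m by simp
    thus ?thesis using has_cubic_ideal_rainbow_ge_4[OF finite_line] h by fastforce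
  qed
qed

lemma card_off_ge: "k \<ge> 1"
proof -
  obtain B where B: "B \<in> \<Delta>" "card B = 3" by (rule ex_basis)
  hence "off \<noteq> {}" using basis_not_subset_line[OF B] face_points[OF B(1)] unfolding off_def by blast
  hence "card off \<noteq> 0" using finite_off by simp
  thus ?thesis by simp
qed

text \<open>The only point \<open>c\<close> off the line lies in every basis, and removing it leaves
  a rainbow pair of the line.\<close>

lemma card_bases_coloop:
  assumes "k = 1"
  shows "int (card bases) = pairs line" "pairs off = 0"
proof -
  obtain c where c: "off = {c}" using assms by (auto simp: card_1_singleton_iff)
  have "rainbow_sets parallel_class off 2 = {}"
    unfolding c by (auto elim: rainbow_pairE)
  thus off: "pairs off = 0" by simp
  have "card bases \<le> card (rainbow_sets parallel_class line 2)"
  proof (rule card_inj_on_le)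
    have mem: "c \<in> B" if "B \<in> bases" for B
    proof -
      have B: "B \<in> \<Delta>" "card B = 3" using that by simp_all
      obtain b where "b \<in> B" "b \<in> off"
        using basis_not_subset_line[OF B] face_points[OF B(1)] unfolding off_def by blast
      thus ?thesis using c by simp
    qed
    show "inj_on (\<lambda>B. B - {c}) bases"
      by (rule inj_on_inverseI[of _ "insert c"]) (use mem in blast)
    show "(\<lambda>B. B - {c}) ` bases \<subseteq> rainbow_sets parallel_class line 2"
    proof (rule image_subsetI)
      fix B assume B: "B \<in> bases"
      have "B \<subseteq> points" using B face_points by simp
      hence "B - off \<subseteq> line" unfolding off_def by blast
      hence "B - {c} \<subseteq> line" unfolding c .
      moreover have "card (B - {c}) = 2" using B mem[OF B] by simp
      moreover have "inj_on parallel_class (B - {c})"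
        using B face_subset[of B "B - {c}"] by (intro inj_on_parallel_class_face) simp
      ultimately show "B - {c} \<in> rainbow_sets parallel_class line 2"
        by (simp add: rainbow_sets_def)
    qed
  qed (simp add: finite_rainbow_sets finite_line)
  thus "int (card bases) = pairs line" using card_bases_ge off assms by simp
qed

text \<open>Here \<open>n = h_1 - 1\<close>, \<open>q = h_2 - h_1\<close> and
  \<open>t = h_3\<close>; the conclusion supplies the lower bounds needed for
  \<open>has_cubic_ideal_free\<close>.\<close>

lemma h_3_bounds:
  fixes n q t :: int
  assumes n: "N = n + 4" and q: "q = pairs points - 3 * N + 6"
    and t: "t = int (card bases) - pairs points + N - 1"
  shows "t = 0 \<or> (q + 1 \<le> t \<and> (q = 0 \<longrightarrow> n \<le> t))"
proof (cases "k = 1")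
  case True
  thus ?thesis using card_bases_coloop[OF True] pairs_points card_points t by simp
next
  case False
  hence k: "k \<ge> 2" using card_off_ge by simp
  have h: "h \<ge> 3" by (rule card_line_ge)
  have "t - q - 1 = int (card bases) - 2 * pairs points + 4 * N - 8"
    using q t by simp
  \<comment> \<open>The factor 2 in \<open>card_bases_ge\<close> makes \<open>pairs off\<close>
    cancel, and the remaining terms factor.\<close>
  also have "\<dots> \<ge> (k - 2) * (pairs line - 2 * h + 4)"
    using card_bases_ge unfolding pairs_points card_points by (simp add: algebra_simps)
  finally have "t - q - 1 \<ge> (k - 2) * (pairs line - 2 * h + 4)" .
  moreover have "(k - 2) * (pairs line - 2 * h + 4) \<ge> 0"
    using k pairs_line_ge by (intro mult_nonneg_nonneg) auto
  ultimately have 1: "q + 1 \<le> t" by linarith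
  have "n \<le> t" if "q = 0"
  proof -
    \<comment> \<open>Vanishing \<open>q\<close> makes this product nonpositive; as
      \<open>k \<ge> 2\<close> and \<open>h \<ge> 3\<close>, the line consists of exactly three
      points and \<open>n = k - 1\<close>.\<close>
    have "(h - 3) * (k - 1) = - (pairs line - 2 * h + 3) - pairs off"
      using q that unfolding pairs_points card_points by (simp add: algebra_simps)
    hence "(h - 3) * (k - 1) \<le> 0" using pairs_line_ge by simp
    hence h3: "h = 3" using h k by (simp add: mult_le_0_iff)
    have "t \<ge> (k - 1) * (pairs line - h + 1)"
      using t card_bases_ge unfolding pairs_points card_points by (simp add: algebra_simps)
    moreover have "(k - 1) * (pairs line - h + 1) \<ge> (k - 1) * 1"
      using k h3 pairs_line_ge by (intro mult_left_mono) auto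
    ultimately show ?thesis using n card_points h3 by simp
  qed
  thus ?thesis using 1 by blast
qed

end

section \<open>Choosing the order ideal for a rank 3 matroid complex\<close>

context matroid_rank_3
begin

theorem pure_O_sequence_h_vector: "pure_O_sequence (drop_trailing_zeros (h_vector \<Delta>))"
proof (cases "card (parallel_class ` points) = 3")
  case True
  \<comment> \<open>With three classes there is no free variable and all rainbow triples are bases,
    so the ideal from the class sizes already fits.\<close>
  hence "bases = rainbow_sets parallel_class points 3"
    using faces_rainbow[of 3] triples_faces_3_classes[OF True] rainbow_setsD(2)[of _ parallel_class points 3] by blast
  moreover obtain n q c where "has_cubic_ideal n q c" "card points = n + 3"
    "int q = pairs points - 2 * N + 3" "int c = triples - pairs points + N - 1"
    using has_cubic_ideal_rainbow_eq_3[OF finite_points True] by blast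
  ultimately show ?thesis
    unfolding h_vector_eq using has_cubic_ideal_imp_pure_O_sequence[of n q c] by simp
next
  case False
  hence "card (parallel_class ` points) = (card (parallel_class ` points) - 4) + 4"
    using card_classes_ge by simp
  then obtain n q c where nqc: "has_cubic_ideal n q c" "card points = n + 4"
    "int q = pairs points - 3 * N + 6" "int c = triples - 2 * pairs points + 3 * N - 4"
    using has_cubic_ideal_rainbow_ge_4[OF finite_points] by blast
  have N: "N = int n + 4" using nqc(2) by simp
  have c0: "c = 0" if "q = 0" using nqc(1) that has_cubic_ideal_no_quadratics by blast
  have "\<exists>t. int t = int (card bases) - pairs points + N - 1 \<and>
      (t = 0 \<or> (q + 1 \<le> t \<and> (q = 0 \<longrightarrow> n \<le> t)))"
  proof (cases "rainbow_sets parallel_class points 3 \<subseteq> \<Delta>")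
    case True
    hence "bases = rainbow_sets parallel_class points 3"
      using faces_rainbow[of 3] rainbow_setsD(2)[of _ parallel_class points 3] by blast
    \<comment> \<open>Without collinear triples the last entry attains the maximum allowed when the
      free variable is adjoined.\<close>
    hence "int (q + n + 1 + c) = int (card bases) - pairs points + N - 1" using nqc by simp
    thus ?thesis by (intro exI[of _ "q + n + 1 + c"]) simp
  next
    case False
    then obtain F where F: "F \<in> rainbow_sets parallel_class points 3" "F \<notin> \<Delta>" by blast
    then obtain x y z where "F = {x, y, z}"
      using rainbow_setsD(2)[OF F(1)] unfolding card_3_iff by blast
    then interpret collinear_triple V \<Delta> x y z
      using F by unfold_locales auto
    define t where "t = int (card bases) - pairs points + N - 1"
    have "t = 0 \<or> (int q + 1 \<le> t \<and> (int q = 0 \<longrightarrow> int n \<le> t))"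
      using h_3_bounds[OF N nqc(3) t_def] .
    moreover from this have "t \<ge> 0" by auto
    then obtain t' where "t = int t'" by (rule nonneg_int_cases)
    ultimately show ?thesis unfolding t_def[symmetric] by (intro exI[of _ t']) auto
  qed
  then obtain t where t: "int t = int (card bases) - pairs points + N - 1"
      "t = 0 \<or> (q + 1 \<le> t \<and> (q = 0 \<longrightarrow> n \<le> t))" by blast
  \<comment> \<open>Bases are rainbow triples, which gives the upper bound. For \<open>q = 0\<close>
    also \<open>c = 0\<close>, so it becomes the \<open>n + 1\<close> required there.\<close>
  have "t \<le> q + n + 1 + c" using card_bases_le nqc t(1) by linarith
  hence "has_cubic_ideal (n + 1) (q + n + 1) t"
    using t(2) c0 by (intro has_cubic_ideal_free[OF nqc(1)]) auto
  moreover have "h_vector \<Delta> = [1, int (n + 1), int (q + n + 1), int t]"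
    unfolding h_vector_eq t(1) using nqc by simp
  ultimately show ?thesis using has_cubic_ideal_imp_pure_O_sequence by metis
qed

end

theorem theorem4p7:
  fixes n :: nat and \<Delta> :: "nat set set"
  assumes "matroid_complex {1..n} \<Delta>"
    and "complex_rank \<Delta> = 3"
  shows "pure_O_sequence (drop_trailing_zeros (h_vector \<Delta>))"
  using assms matroid_rank_3.pure_O_sequence_h_vector matroid_rank_3.intro by blast

end
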